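(* Let $f:\mathfrak{g}\twoheadrightarrow\mathfrak{q}$ be a $\mathrm{Lie}$-central extension of Leibniz algebras over $\mathbb{K}$ with $\mathfrak{n}=\ker(f)$. The following statements are equivalent: (a) $f:\mathfrak{g}\twoheadrightarrow\mathfrak{q}$ is a $\mathrm{Lie}$-stem extension. (b) The induced map $\mathfrak{n}\to HL^{\mathrm{Lie}}_1(\mathfrak{g})$ is the zero map. (c) $\theta^{*}(\mathfrak{g}):HL^{\mathrm{Lie}}_2(\mathfrak{q})\to\mathfrak{n}$ is an epimorphism. (d) The sequence $\mathfrak{n}\otimes\mathfrak{g}_{\mathrm{Lie}}\to HL^{\mathrm{Lie}}_2(\mathfrak{g})\to HL^{\mathrm{Lie}}_2(\mathfrak{q})\stackrel{\theta^{*}(\mathfrak{g})}{\to}\mathfrak{n}\to0$ is exact. (e) $\mathfrak{n}\subseteq\mathfrak{g}^{\mathrm{ann}}$.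
   Context: $\mathbb{K}$ is a field with $\frac12\in\mathbb{K}$; tensor products are over $\mathbb{K}$. A Leibniz algebra is a $\mathbb{K}$-vector space $\mathfrak{q}$ with a bilinear bracket satisfying $[x,[y,z]]=[[x,y],z]-[[x,z],y]$. $\mathfrak{q}^{\mathrm{ann}}$ is the span of all $[x,x]$, $x\in\mathfrak{q}$ (a two-sided ideal), and $\mathfrak{q}_{\mathrm{Lie}}=\mathfrak{q}/\mathfrak{q}^{\mathrm{ann}}$. For two-sided ideals $\mathfrak{m},\mathfrak{n}$ of $\mathfrak{q}$, $[\mathfrak{m},\mathfrak{n}]_{\mathrm{Lie}}$ is the span of all $[m,n]+[n,m]$, $m\in\mathfrak{m}$, $n\in\mathfrak{n}$. An extension is a surjective homomorphism $f:\mathfrak{g}\twoheadrightarrow\mathfrak{q}$ of Leibniz algebras; with $\mathfrak{n}=\ker f$ it is $\mathrm{Lie}$-central if $[\mathfrak{n},\mathfrak{g}]_{\mathrm{Lie}}=0$. A $\mathrm{Lie}$-central extension is a $\mathrm{Lie}$-stem extension if the map $\mathfrak{g}_{\mathrm{Lie}}\to\mathfrak{q}_{\mathrm{Lie}}$ induced by $f$ is an isomorphism. $HL^{\mathrm{Lie}}_1(\mathfrak{g})=\mathfrak{g}_{\mathrm{Lie}}$. For a free presentation $0\to\mathfrak{r}\to\mathfrak{f}\stackrel{\rho}{\to}\mathfrak{g}\to0$ ($\mathfrak{f}$ a free Leibniz algebra), $HL^{\mathrm{Lie}}_2(\mathfrak{g})=(\mathfrak{r}\cap[\mathfrak{f},\mathfrak{f}]_{\mathrm{Lie}})/[\mathfrak{r},\mathfrak{f}]_{\mathrm{Lie}}$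 (independent of the presentation up to canonical isomorphism). Given a $\mathrm{Lie}$-central extension $f:\mathfrak{g}\twoheadrightarrow\mathfrak{q}$ with kernel $\mathfrak{n}$, use the free presentation $0\to\mathfrak{s}\to\mathfrak{f}\stackrel{f\circ\rho}{\to}\mathfrak{q}\to0$ of $\mathfrak{q}$: the map $HL^{\mathrm{Lie}}_2(\mathfrak{g})\to HL^{\mathrm{Lie}}_2(\mathfrak{q})$ is induced by $\mathfrak{r}\subseteq\mathfrak{s}$; $\theta^{*}(\mathfrak{g}):HL^{\mathrm{Lie}}_2(\mathfrak{q})\to\mathfrak{n}$ is induced by $\rho$; the map $\mathfrak{n}\to HL^{\mathrm{Lie}}_1(\mathfrak{g})$ is $\mathfrak{n}\hookrightarrow\mathfrak{g}\twoheadrightarrow\mathfrak{g}_{\mathrm{Lie}}$; and the map $\mathfrak{n}\otimes\mathfrak{g}_{\mathrm{Lie}}\to HL^{\mathrm{Lie}}_2(\mathfrak{g})$ is given by $n\otimes\overline{x}\mapsto[s,y]+[y,s]+[\mathfrak{r},\mathfrak{f}]_{\mathrm{Lie}}$, where $s\in\mathfrak{s}$, $y\in\mathfrak{f}$, $\rho(s)=n$, $\rho(y)=x$.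
   Formalization: In (d) the formula for the map n⊗g_Lie → HL_2(g) need not be well defined for a general Lie-central extension, so (d) is read as: the formula gives a well-defined linear map, and with it the sequence is exact. *)

theory Defs
  imports Complex_Main "HOL-Library.Poly_Mapping"
begin

section \<open>Vector spaces and algebras on a carrier\<close>

text \<open>
  The algebras of an extension live on whole types, with the library's locale
  \<^locale>\<open>vector_space\<close>.  The spaces derived from them (quotients, kernels, tensor
  products) have a proper subset of a type as carrier; they are packed into these records.
\<close>

record ('k, 'a) kspace =
  car  :: "'a set"
  add  :: "'a \<Rightarrow> 'a \<Rightarrow> 'a"
  zer  :: "'a"
  smul :: "'k \<Rightarrow> 'a \<Rightarrow> 'a"

record ('k, 'a) kalgebra = "('k, 'a) kspace" +
  brk :: "'a \<Rightarrow> 'a \<Rightarrow> 'a"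

definition klinear ::
  "('k, 'a, 'm) kspace_scheme \<Rightarrow> ('k, 'b, 'n) kspace_scheme \<Rightarrow> ('a \<Rightarrow> 'b) \<Rightarrow> bool" where
  "klinear V W h \<longleftrightarrow>
     (\<forall>x\<in>car V. h x \<in> car W) \<and>
     (\<forall>x\<in>car V. \<forall>y\<in>car V. h (add V x y) = add W (h x) (h y)) \<and>
     (\<forall>c. \<forall>x\<in>car V. h (smul V c x) = smul W c (h x))"

definition kzero_map ::
  "('k, 'a, 'm) kspace_scheme \<Rightarrow> ('k, 'b, 'n) kspace_scheme \<Rightarrow> ('a \<Rightarrow> 'b) \<Rightarrow> bool" where
  "kzero_map V W h \<longleftrightarrow> (\<forall>x\<in>car V. h x = zer W)"

definition kepi ::
  "('k, 'a, 'm) kspace_scheme \<Rightarrow> ('k, 'b, 'n) kspace_scheme \<Rightarrow> ('a \<Rightarrow> 'b) \<Rightarrow> bool" where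
  "kepi V W h \<longleftrightarrow> klinear V W h \<and> h ` car V = car W"

definition kexact ::
  "('k, 'a, 'm) kspace_scheme \<Rightarrow> ('a \<Rightarrow> 'b) \<Rightarrow> ('k, 'b, 'n) kspace_scheme
     \<Rightarrow> ('b \<Rightarrow> 'c) \<Rightarrow> ('k, 'c, 'p) kspace_scheme \<Rightarrow> bool" where
  "kexact U h V h' W \<longleftrightarrow>
     klinear U V h \<and> klinear V W h' \<and> h ` car U = {y \<in> car V. h' y = zer W}"

definition kalgebra_iso ::
  "('k, 'a) kalgebra \<Rightarrow> ('k, 'b) kalgebra \<Rightarrow> ('a \<Rightarrow> 'b) \<Rightarrow> bool" where
  "kalgebra_iso A B h \<longleftrightarrow>
     klinear A B h \<and> (\<forall>x\<in>car A. \<forall>y\<in>car A. h (brk A x y) = brk B (h x) (h y)) \<and>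
     bij_betw h (car A) (car B)"

definition sub_space :: "('k \<Rightarrow> 'a \<Rightarrow> 'a) \<Rightarrow> 'a set \<Rightarrow> ('k, 'a::ab_group_add) kspace" where
  "sub_space scale U = \<lparr>car = U, add = (+), zer = 0, smul = scale\<rparr>"

definition coset :: "'a::ab_group_add set \<Rightarrow> 'a \<Rightarrow> 'a set" where
  "coset W x = {x + w |w. w \<in> W}"

text \<open>
  For subspaces \<open>W \<subseteq> U\<close> the quotient \<open>U/W\<close>, with cosets as elements.  In a scalar multiple
  (or a bracket) of cosets the subspace \<open>W\<close> is added again, so that also \<open>0 \<cdot> (x + W) = W\<close>.
\<close>

definition quot_space ::
  "('k \<Rightarrow> 'a \<Rightarrow> 'a) \<Rightarrow> 'a set \<Rightarrow> 'a set \<Rightarrow> ('k, 'a::ab_group_add set) kspace" where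
  "quot_space scale U W =
     \<lparr>car = coset W ` U,
      add = (\<lambda>C D. {c + d |c d. c \<in> C \<and> d \<in> D}),
      zer = W,
      smul = (\<lambda>a C. {scale a c + w |c w. c \<in> C \<and> w \<in> W})\<rparr>"

definition quot_algebra ::
  "('k \<Rightarrow> 'a \<Rightarrow> 'a) \<Rightarrow> ('a \<Rightarrow> 'a \<Rightarrow> 'a) \<Rightarrow> 'a set \<Rightarrow> ('k, 'a::ab_group_add set) kalgebra" where
  "quot_algebra scale bracket W =
     kspace.extend (quot_space scale UNIV W)
       \<lparr>brk = (\<lambda>C D. {bracket c d + w |c d w. c \<in> C \<and> d \<in> D \<and> w \<in> W})\<rparr>"

text \<open>
  If \<open>h\<close> is linear and maps \<open>W\<close> into \<open>W'\<close>, then \<open>quot_map W' h\<close> sends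
  \<open>x + W\<close> to \<open>h x + W'\<close>, i.e. it is the map induced by \<open>h\<close> on the quotients.
\<close>

definition quot_map :: "'b::ab_group_add set \<Rightarrow> ('a \<Rightarrow> 'b) \<Rightarrow> 'a set \<Rightarrow> 'b set" where
  "quot_map W' h C = {h c + w' |c w'. c \<in> C \<and> w' \<in> W'}"


section \<open>Tensor products\<close>

text \<open>
  \<open>V \<otimes> W\<close> is the free vector space on the set \<open>V \<times> W\<close> (finitely supported
  functions) modulo the bilinearity relations.
\<close>

definition pm_scale :: "'k::field \<Rightarrow> ('i \<Rightarrow>\<^sub>0 'k) \<Rightarrow> ('i \<Rightarrow>\<^sub>0 'k)" where
  "pm_scale c p = Poly_Mapping.map (\<lambda>a. c * a) p"

abbreviation pair_gen :: "'a \<Rightarrow> 'b \<Rightarrow> ('a \<times> 'b) \<Rightarrow>\<^sub>0 'k::field" where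
  "pair_gen v w \<equiv> Poly_Mapping.single (v, w) 1"

definition tensor_rel ::
  "('k::field, 'a, 'm) kspace_scheme \<Rightarrow> ('k, 'b, 'n) kspace_scheme \<Rightarrow> (('a \<times> 'b) \<Rightarrow>\<^sub>0 'k) set" where
  "tensor_rel V W = module.span pm_scale
     ({pair_gen (add V v v') w - pair_gen v w - pair_gen v' w |v v' w.
         v \<in> car V \<and> v' \<in> car V \<and> w \<in> car W} \<union>
      {pair_gen v (add W w w') - pair_gen v w - pair_gen v w' |v w w'.
         v \<in> car V \<and> w \<in> car W \<and> w' \<in> car W} \<union>
      {pair_gen (smul V c v) w - pm_scale c (pair_gen v w) |c v w. v \<in> car V \<and> w \<in> car W} \<union>
      {pair_gen v (smul W c w) - pm_scale c (pair_gen v w) |c v w. v \<in> car V \<and> w \<in> car W})"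

definition tensor ::
  "('k::field, 'a, 'm) kspace_scheme \<Rightarrow> ('k, 'b, 'n) kspace_scheme
     \<Rightarrow> ('k, (('a \<times> 'b) \<Rightarrow>\<^sub>0 'k) set) kspace" where
  "tensor V W =
     quot_space pm_scale {p. Poly_Mapping.keys p \<subseteq> car V \<times> car W} (tensor_rel V W)"

definition pure_tensor ::
  "('k::field, 'a, 'm) kspace_scheme \<Rightarrow> ('k, 'b, 'n) kspace_scheme
     \<Rightarrow> 'a \<Rightarrow> 'b \<Rightarrow> (('a \<times> 'b) \<Rightarrow>\<^sub>0 'k) set" where
  "pure_tensor V W v w = coset (tensor_rel V W) (pair_gen v w)"


section \<open>Leibniz algebras\<close>

locale leibniz_algebra = vector_space scale
  for scale :: "'k::field \<Rightarrow> 'a::ab_group_add \<Rightarrow> 'a" +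
  fixes bracket :: "'a \<Rightarrow> 'a \<Rightarrow> 'a"
  assumes bracket_linear_left: "Vector_Spaces.linear scale scale (\<lambda>x. bracket x y)"
    and bracket_linear_right: "Vector_Spaces.linear scale scale (\<lambda>y. bracket x y)"
    and leibniz: "bracket x (bracket y z) = bracket (bracket x y) z - bracket (bracket x z) y"

definition leibniz_hom ::
  "('k::field \<Rightarrow> 'a::ab_group_add \<Rightarrow> 'a) \<Rightarrow> ('a \<Rightarrow> 'a \<Rightarrow> 'a) \<Rightarrow>
   ('k \<Rightarrow> 'b::ab_group_add \<Rightarrow> 'b) \<Rightarrow> ('b \<Rightarrow> 'b \<Rightarrow> 'b) \<Rightarrow> ('a \<Rightarrow> 'b) \<Rightarrow> bool" where
  "leibniz_hom sa ba sb bb h \<longleftrightarrow>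
     Vector_Spaces.linear sa sb h \<and> (\<forall>x y. h (ba x y) = bb (h x) (h y))"

definition ker :: "('a \<Rightarrow> 'b::zero) \<Rightarrow> 'a set" where
  "ker h = {x. h x = 0}"

definition lie_ann ::
  "('k::field \<Rightarrow> 'a::ab_group_add \<Rightarrow> 'a) \<Rightarrow> ('a \<Rightarrow> 'a \<Rightarrow> 'a) \<Rightarrow> 'a set" where
  "lie_ann scale bracket = module.span scale {bracket x x |x. True}"

definition lie_quotient ::
  "('k::field \<Rightarrow> 'a::ab_group_add \<Rightarrow> 'a) \<Rightarrow> ('a \<Rightarrow> 'a \<Rightarrow> 'a) \<Rightarrow> ('k, 'a set) kalgebra" where
  "lie_quotient scale bracket = quot_algebra scale bracket (lie_ann scale bracket)"

definition lie_commutator ::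
  "('k::field \<Rightarrow> 'a::ab_group_add \<Rightarrow> 'a) \<Rightarrow> ('a \<Rightarrow> 'a \<Rightarrow> 'a) \<Rightarrow> 'a set \<Rightarrow> 'a set \<Rightarrow> 'a set" where
  "lie_commutator scale bracket M N =
     module.span scale {bracket m n + bracket n m |m n. m \<in> M \<and> n \<in> N}"

definition leibniz_extension ::
  "('k::field \<Rightarrow> 'a::ab_group_add \<Rightarrow> 'a) \<Rightarrow> ('a \<Rightarrow> 'a \<Rightarrow> 'a) \<Rightarrow>
   ('k \<Rightarrow> 'b::ab_group_add \<Rightarrow> 'b) \<Rightarrow> ('b \<Rightarrow> 'b \<Rightarrow> 'b) \<Rightarrow> ('a \<Rightarrow> 'b) \<Rightarrow> bool" where
  "leibniz_extension sg bg sq bq f \<longleftrightarrow>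
     leibniz_algebra sg bg \<and> leibniz_algebra sq bq \<and> leibniz_hom sg bg sq bq f \<and> surj f"

definition lie_central_extension ::
  "('k::field \<Rightarrow> 'a::ab_group_add \<Rightarrow> 'a) \<Rightarrow> ('a \<Rightarrow> 'a \<Rightarrow> 'a) \<Rightarrow>
   ('k \<Rightarrow> 'b::ab_group_add \<Rightarrow> 'b) \<Rightarrow> ('b \<Rightarrow> 'b \<Rightarrow> 'b) \<Rightarrow> ('a \<Rightarrow> 'b) \<Rightarrow> bool" where
  "lie_central_extension sg bg sq bq f \<longleftrightarrow>
     leibniz_extension sg bg sq bq f \<and> lie_commutator sg bg (ker f) UNIV = {0}"

definition lie_stem_extension ::
  "('k::field \<Rightarrow> 'a::ab_group_add \<Rightarrow> 'a) \<Rightarrow> ('a \<Rightarrow> 'a \<Rightarrow> 'a) \<Rightarrow>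
   ('k \<Rightarrow> 'b::ab_group_add \<Rightarrow> 'b) \<Rightarrow> ('b \<Rightarrow> 'b \<Rightarrow> 'b) \<Rightarrow> ('a \<Rightarrow> 'b) \<Rightarrow> bool" where
  "lie_stem_extension sg bg sq bq f \<longleftrightarrow>
     lie_central_extension sg bg sq bq f \<and>
     kalgebra_iso (lie_quotient sg bg) (lie_quotient sq bq) (quot_map (lie_ann sq bq) f)"


section \<open>Free Leibniz algebras\<close>

text \<open>
  The universal property of a free Leibniz algebra quantifies over algebras on arbitrary types,
  which is not possible inside a HOL definition.  Freeness is therefore defined by generators and
  relations: a Leibniz algebra is free on a subset \<open>X\<close> if \<open>X\<close> generates it and
  two formal expressions in \<open>X\<close> have the same value only if their equality follows from the
  axioms of Leibniz algebras.  The universal property is derived below for targets of any type.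
\<close>

datatype (gens: 'x, dead 'k) lterm =
    Gen 'x
  | Zero
  | Plus "('x, 'k) lterm" "('x, 'k) lterm"
  | Scale 'k "('x, 'k) lterm"
  | Brk "('x, 'k) lterm" "('x, 'k) lterm"
  for map: map_lterm

inductive leib_eq :: "('x, 'k::field) lterm \<Rightarrow> ('x, 'k) lterm \<Rightarrow> bool" where
  le_refl: "leib_eq t t"
| le_sym: "leib_eq t u \<Longrightarrow> leib_eq u t"
| le_trans: "leib_eq t u \<Longrightarrow> leib_eq u v \<Longrightarrow> leib_eq t v"
| cong_Plus: "leib_eq t t' \<Longrightarrow> leib_eq u u' \<Longrightarrow> leib_eq (Plus t u) (Plus t' u')"
| cong_Scale: "leib_eq t t' \<Longrightarrow> leib_eq (Scale a t) (Scale a t')"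
| cong_Brk: "leib_eq t t' \<Longrightarrow> leib_eq u u' \<Longrightarrow> leib_eq (Brk t u) (Brk t' u')"
| Plus_assoc: "leib_eq (Plus (Plus t u) v) (Plus t (Plus u v))"
| Plus_comm: "leib_eq (Plus t u) (Plus u t)"
| Plus_Zero: "leib_eq (Plus Zero t) t"
| Plus_inverse: "leib_eq (Plus (Scale (- 1) t) t) Zero"
| Scale_Plus: "leib_eq (Scale a (Plus t u)) (Plus (Scale a t) (Scale a u))"
| Scale_plus: "leib_eq (Scale (a + b) t) (Plus (Scale a t) (Scale b t))"
| Scale_Scale: "leib_eq (Scale a (Scale b t)) (Scale (a * b) t)"
| Scale_one: "leib_eq (Scale 1 t) t"
| Brk_Plus_left: "leib_eq (Brk (Plus t u) v) (Plus (Brk t v) (Brk u v))"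
| Brk_Plus_right: "leib_eq (Brk t (Plus u v)) (Plus (Brk t u) (Brk t v))"
| Brk_Scale_left: "leib_eq (Brk (Scale a t) u) (Scale a (Brk t u))"
| Brk_Scale_right: "leib_eq (Brk t (Scale a u)) (Scale a (Brk t u))"
| Leibniz:
    "leib_eq (Brk t (Brk u v)) (Plus (Brk (Brk t u) v) (Scale (- 1) (Brk (Brk t v) u)))"

primrec lvalue ::
  "('k::field \<Rightarrow> 'a::ab_group_add \<Rightarrow> 'a) \<Rightarrow> ('a \<Rightarrow> 'a \<Rightarrow> 'a) \<Rightarrow> ('x \<Rightarrow> 'a) \<Rightarrow> ('x, 'k) lterm \<Rightarrow> 'a" where
  "lvalue scale bracket h (Gen x) = h x"
| "lvalue scale bracket h Zero = 0"
| "lvalue scale bracket h (Plus t u) = lvalue scale bracket h t + lvalue scale bracket h u"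
| "lvalue scale bracket h (Scale a t) = scale a (lvalue scale bracket h t)"
| "lvalue scale bracket h (Brk t u) = bracket (lvalue scale bracket h t) (lvalue scale bracket h u)"

definition free_leibniz_on ::
  "('k::field \<Rightarrow> 'a::ab_group_add \<Rightarrow> 'a) \<Rightarrow> ('a \<Rightarrow> 'a \<Rightarrow> 'a) \<Rightarrow> 'a set \<Rightarrow> bool" where
  "free_leibniz_on scale bracket X \<longleftrightarrow>
     leibniz_algebra scale bracket \<and>
     (\<forall>v. \<exists>t. gens t \<subseteq> X \<and> lvalue scale bracket id t = v) \<and>
     (\<forall>t u. gens t \<subseteq> X \<and> gens u \<subseteq> X \<and>
        lvalue scale bracket id t = lvalue scale bracket id u \<longrightarrow> leib_eq t u)"

definition free_leibniz ::
  "('k::field \<Rightarrow> 'a::ab_group_add \<Rightarrow> 'a) \<Rightarrow> ('a \<Rightarrow> 'a \<Rightarrow> 'a) \<Rightarrow> bool" where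
  "free_leibniz scale bracket \<longleftrightarrow> (\<exists>X. free_leibniz_on scale bracket X)"

definition free_presentation ::
  "('k::field \<Rightarrow> 'f::ab_group_add \<Rightarrow> 'f) \<Rightarrow> ('f \<Rightarrow> 'f \<Rightarrow> 'f) \<Rightarrow>
   ('k \<Rightarrow> 'a::ab_group_add \<Rightarrow> 'a) \<Rightarrow> ('a \<Rightarrow> 'a \<Rightarrow> 'a) \<Rightarrow> ('f \<Rightarrow> 'a) \<Rightarrow> bool" where
  "free_presentation sf bf sg bg \<rho> \<longleftrightarrow>
     free_leibniz sf bf \<and> leibniz_extension sf bf sg bg \<rho>"


subsection \<open>The universal property\<close>

lemma (in leibniz_algebra) bracket_simps:
  "bracket (x + y) z = bracket x z + bracket y z"
  "bracket z (x + y) = bracket z x + bracket z y"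
  "bracket (scale a x) z = scale a (bracket x z)"
  "bracket z (scale a x) = scale a (bracket z x)"
  using bracket_linear_left[of z] bracket_linear_right[of z]
  by (simp_all add: Vector_Spaces.linear_iff)

lemma leib_eq_sound:
  assumes "leibniz_algebra scale bracket" "leib_eq t u"
  shows "lvalue scale bracket h t = lvalue scale bracket h u"
proof -
  interpret leibniz_algebra scale bracket by fact
  from assms(2) show ?thesis
    by (induction rule: leib_eq.induct)
      (auto simp: add.assoc scale_right_distrib scale_left_distrib bracket_simps leibniz
        intro: add.commute)
qed

lemma lvalue_hom:
  assumes "leibniz_hom sf bf sa ba h" "leibniz_algebra sf bf"
  shows "h (lvalue sf bf e t) = lvalue sa ba (h \<circ> e) t"
proof -
  have "h (x + y) = h x + h y" "h (sf a x) = sa a (h x)" "h (bf x y) = ba (h x) (h y)" for a x y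
    using assms(1) by (auto simp: leibniz_hom_def Vector_Spaces.linear_iff)
  moreover from this(1)[of 0 0] have "h 0 = 0" by simp
  ultimately show ?thesis by (induction t) auto
qed

lemma lvalue_cong:
  "(\<And>x. x \<in> gens t \<Longrightarrow> h x = h' x) \<Longrightarrow> lvalue scale bracket h t = lvalue scale bracket h' t"
  by (induction t) auto

theorem free_leibniz_on_universal:
  assumes free: "free_leibniz_on sf bf X" and alg: "leibniz_algebra sa ba"
  shows "\<exists>!h. leibniz_hom sf bf sa ba h \<and> (\<forall>x\<in>X. h x = u x)"
proof -
  interpret F: leibniz_algebra sf bf using free by (simp add: free_leibniz_on_def)
  interpret A: leibniz_algebra sa ba by fact
  define T where "T v = (SOME t. gens t \<subseteq> X \<and> lvalue sf bf id t = v)" for v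
  have T: "gens (T v) \<subseteq> X" "lvalue sf bf id (T v) = v" for v
    using free someI_ex[of "\<lambda>t. gens t \<subseteq> X \<and> lvalue sf bf id t = v"]
    unfolding free_leibniz_on_def T_def by blast+
  define h where "h v = lvalue sa ba u (T v)" for v
  have h: "h v = lvalue sa ba u t" if "gens t \<subseteq> X" "lvalue sf bf id t = v" for t v
  proof -
    have "leib_eq (T v) t"
      using free that T[of v] unfolding free_leibniz_on_def by metis
    then show ?thesis unfolding h_def by (rule leib_eq_sound[OF alg])
  qed
  show ?thesis
  proof (rule ex1I[of _ h], intro conjI ballI)
    have "h (x + y) = h x + h y" for x y
      using h[of "Plus (T x) (T y)" "x + y"] T by (simp add: h_def)
    moreover have "h (sf a x) = sa a (h x)" for a x
      using h[of "Scale a (T x)" "sf a x"] T by (simp add: h_def)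
    moreover have "h (bf x y) = ba (h x) (h y)" for x y
      using h[of "Brk (T x) (T y)" "bf x y"] T by (simp add: h_def)
    ultimately show "leibniz_hom sf bf sa ba h"
      using F.vector_space_axioms A.vector_space_axioms
      by (simp add: leibniz_hom_def Vector_Spaces.linear_iff)
    show "h x = u x" if "x \<in> X" for x
      using h[of "Gen x" x] that by simp
  next
    fix k assume k: "leibniz_hom sf bf sa ba k \<and> (\<forall>x\<in>X. k x = u x)"
    show "k = h"
    proof
      fix v
      have "k v = lvalue sa ba (k \<circ> id) (T v)"
        using lvalue_hom[of sf bf sa ba k id "T v"] k F.leibniz_algebra_axioms T(2) by simp
      also have "\<dots> = h v"
        unfolding h_def by (rule lvalue_cong) (use T(1) k in auto)
      finally show "k v = h v" .
    qed
  qed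
qed


subsection \<open>Existence of free presentations\<close>

quotient_type (overloaded) ('x, 'k) free_leib = "('x, 'k::field) lterm" / leib_eq
  by (rule equivpI) (auto intro!: reflpI sympI transpI intro: leib_eq.intros)

instantiation free_leib :: (type, field) ab_group_add
begin

lift_definition zero_free_leib :: "('a, 'b) free_leib" is Zero .
lift_definition plus_free_leib :: "('a, 'b) free_leib \<Rightarrow> ('a, 'b) free_leib \<Rightarrow> ('a, 'b) free_leib"
  is Plus by (rule cong_Plus)
lift_definition uminus_free_leib :: "('a, 'b) free_leib \<Rightarrow> ('a, 'b) free_leib"
  is "Scale (- 1)" by (rule cong_Scale)
definition minus_free_leib :: "('a, 'b) free_leib \<Rightarrow> ('a, 'b) free_leib \<Rightarrow> ('a, 'b) free_leib"
  where "minus_free_leib x y = x + - y"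

instance
  by standard
    (unfold minus_free_leib_def,
      (transfer, rule Plus_assoc Plus_comm Plus_Zero Plus_inverse | rule refl)+)

end

lift_definition fl_gen :: "'x \<Rightarrow> ('x, 'k::field) free_leib" is Gen .
lift_definition fl_scale :: "'k::field \<Rightarrow> ('x, 'k) free_leib \<Rightarrow> ('x, 'k) free_leib"
  is Scale by (rule cong_Scale)
lift_definition fl_brk :: "('x, 'k::field) free_leib \<Rightarrow> ('x, 'k) free_leib \<Rightarrow> ('x, 'k) free_leib"
  is Brk by (rule cong_Brk)

lemma fl_uminus: "- x = fl_scale (- 1) x"
  by transfer (rule le_refl)

lemma fl_algebra:
  "leibniz_algebra fl_scale (fl_brk :: ('x, 'k::field) free_leib \<Rightarrow> _)"
proof -
  have vs: "vector_space (fl_scale :: 'k \<Rightarrow> ('x, 'k) free_leib \<Rightarrow> _)"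
    by standard (transfer, rule Scale_Plus Scale_plus Scale_Scale Scale_one)+
  have "fl_brk (x + y) z = fl_brk x z + fl_brk y z" "fl_brk z (x + y) = fl_brk z x + fl_brk z y"
    "fl_brk (fl_scale a x) z = fl_scale a (fl_brk x z)"
    "fl_brk z (fl_scale a x) = fl_scale a (fl_brk z x)"
    "fl_brk x (fl_brk y z) = fl_brk (fl_brk x y) z - fl_brk (fl_brk x z) y"
    for x y z :: "('x, 'k) free_leib" and a
    unfolding minus_free_leib_def fl_uminus
    by (transfer, rule Brk_Plus_left Brk_Plus_right Brk_Scale_left Brk_Scale_right Leibniz)+
  with vs show ?thesis
    by (auto simp: leibniz_algebra_def leibniz_algebra_axioms_def Vector_Spaces.linear_iff)
qed

lemma fl_lvalue: "lvalue fl_scale fl_brk fl_gen t = abs_free_leib t"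
  by (induction t)
    (simp_all add: fl_gen.abs_eq zero_free_leib.abs_eq plus_free_leib.abs_eq
      fl_scale.abs_eq fl_brk.abs_eq)

lemma lvalue_map: "lvalue scale bracket h (map_lterm g t) = lvalue scale bracket (h \<circ> g) t"
  by (induction t) auto

lemma leib_eq_map: "leib_eq t u \<Longrightarrow> leib_eq (map_lterm g t) (map_lterm g u)"
  by (induction rule: leib_eq.induct) (auto intro: leib_eq.intros)

lemma fl_free: "free_leibniz_on fl_scale fl_brk (range (fl_gen :: 'x \<Rightarrow> ('x, 'k::field) free_leib))"
  unfolding free_leibniz_on_def
proof (intro conjI allI impI fl_algebra)
  fix v :: "('x, 'k) free_leib"
  obtain t where "v = abs_free_leib t"
    by (metis Quotient_abs_rep[OF Quotient_free_leib])
  then have "lvalue fl_scale fl_brk id (map_lterm fl_gen t) = v"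
    by (simp add: lvalue_map fl_lvalue)
  moreover have "gens (map_lterm fl_gen t) \<subseteq> range (fl_gen :: 'x \<Rightarrow> ('x, 'k) free_leib)"
    by (auto simp: lterm.set_map)
  ultimately show "\<exists>t. gens t \<subseteq> range (fl_gen :: 'x \<Rightarrow> ('x, 'k) free_leib) \<and>
    lvalue fl_scale fl_brk id t = v" by blast
next
  fix t u :: "(('x, 'k) free_leib, 'k) lterm"
  assume *: "gens t \<subseteq> range fl_gen \<and> gens u \<subseteq> range fl_gen \<and>
    lvalue fl_scale fl_brk id t = lvalue fl_scale fl_brk id u"
  let ?g = "inv fl_gen :: ('x, 'k) free_leib \<Rightarrow> 'x"
  have pull: "map_lterm fl_gen (map_lterm ?g w) = w" if "gens w \<subseteq> range fl_gen" for w :: "(('x, 'k) free_leib, 'k) lterm"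
  proof -
    have "map_lterm (fl_gen \<circ> ?g) w = map_lterm id w"
      by (rule lterm.map_cong0) (use that in \<open>auto simp: f_inv_into_f\<close>)
    then show ?thesis by (simp add: lterm.map_comp lterm.map_id)
  qed
  obtain t' u' where t': "t = map_lterm fl_gen t'" and u': "u = map_lterm fl_gen u'"
    using pull * by metis
  with * have "leib_eq t' u'"
    by (simp add: lvalue_map fl_lvalue free_leib.abs_eq_iff)
  then show "leib_eq t u" unfolding t' u' by (rule leib_eq_map)
qed

theorem free_presentation_exists:
  fixes sg :: "'k::field \<Rightarrow> 'g::ab_group_add \<Rightarrow> 'g"
  assumes "leibniz_algebra sg bg"
  shows "\<exists>\<rho> :: ('g, 'k) free_leib \<Rightarrow> 'g. free_presentation fl_scale fl_brk sg bg \<rho>"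
proof -
  define v where "v = (\<lambda>x :: ('g, 'k) free_leib. (SOME g. x = fl_gen g))"
  obtain \<rho> :: "('g, 'k) free_leib \<Rightarrow> 'g" where \<rho>: "leibniz_hom fl_scale fl_brk sg bg \<rho>"
    and v: "\<forall>x\<in>range fl_gen. \<rho> x = v x"
    using free_leibniz_on_universal[OF fl_free assms, of v] by blast
  have inj: "g = g'" if "fl_gen g = (fl_gen g' :: ('g, 'k) free_leib)" for g g'
  proof -
    from that have "leib_eq (Gen g) (Gen g' :: ('g, 'k) lterm)" by transfer
    then show ?thesis using leib_eq_sound[OF assms, of "Gen g" "Gen g'" id] by simp
  qed
  have "\<rho> (fl_gen g) = g" for g
    using v inj unfolding v_def by (metis (mono_tags, lifting) rangeI someI)
  then have "surj \<rho>" by (metis surjI)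
  then show ?thesis
    using \<rho> assms fl_free fl_algebra
    by (auto simp: free_presentation_def free_leibniz_def leibniz_extension_def)
qed


section \<open>Homology\<close>

text \<open>
  For a free presentation of an algebra by \<open>(sf, bf)\<close> with kernel \<open>r\<close>.  Below, \<open>\<rho>\<close> is
  a free presentation of \<open>\<gg>\<close> and \<open>f \<circ> \<rho>\<close> the resulting one of \<open>\<qq>\<close>.
\<close>

definition HL2 ::
  "('k::field \<Rightarrow> 'f::ab_group_add \<Rightarrow> 'f) \<Rightarrow> ('f \<Rightarrow> 'f \<Rightarrow> 'f) \<Rightarrow> 'f set \<Rightarrow> ('k, 'f set) kspace" where
  "HL2 sf bf r = quot_space sf (r \<inter> lie_commutator sf bf UNIV UNIV) (lie_commutator sf bf r UNIV)"

definition HL2_map ::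
  "('k::field \<Rightarrow> 'f::ab_group_add \<Rightarrow> 'f) \<Rightarrow> ('f \<Rightarrow> 'f \<Rightarrow> 'f) \<Rightarrow> 'f set \<Rightarrow> 'f set \<Rightarrow> 'f set" where
  "HL2_map sf bf s = quot_map (lie_commutator sf bf s UNIV) id"

text \<open>
  If the extension is Lie-central, \<open>\<rho>\<close> vanishes on \<open>[\<ss>, \<ff>]\<^sub>L\<^sub>i\<^sub>e\<close>, so it is constant on each coset.
\<close>

definition theta :: "('f \<Rightarrow> 'g) \<Rightarrow> 'f set \<Rightarrow> 'g" where
  "theta \<rho> C = the_elem (\<rho> ` C)"

definition HL1 ::
  "('k::field \<Rightarrow> 'a::ab_group_add \<Rightarrow> 'a) \<Rightarrow> ('a \<Rightarrow> 'a \<Rightarrow> 'a) \<Rightarrow> ('k, 'a set) kalgebra" where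
  "HL1 = lie_quotient"

text \<open>
  \<open>j\<close> is the linear map on \<open>\<nn> \<otimes> \<gg>\<^sub>L\<^sub>i\<^sub>e\<close> determined by
  \<open>n \<otimes> (x + \<gg>\<^sup>a\<^sup>n\<^sup>n) \<mapsto> [s, y] + [y, s] + [\<rr>, \<ff>]\<^sub>L\<^sub>i\<^sub>e\<close>, for all \<open>s\<close>, \<open>y\<close> with
  \<open>\<rho> s = n\<close> and \<open>\<rho> y = x\<close>.  At most one such map exists on the carrier, since pure tensors
  span.  The formula is a predicate because for a general Lie-central extension it need not
  respect \<open>\<gg>\<^sup>a\<^sup>n\<^sup>n\<close>: if \<open>\<ff>\<close> is free on \<open>y, z\<close>, \<open>\<ss>\<close> is the ideal
  generated by \<open>z\<close> and \<open>\<rr> = [\<ss>, \<ff>]\<^sub>L\<^sub>i\<^sub>e\<close>, then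
  \<open>[z, [y, y]] + [[y, y], z] = [[y, y], z]\<close> is not in \<open>[\<rr>, \<ff>]\<^sub>L\<^sub>i\<^sub>e\<close>.
  It does define a map when \<open>\<nn> \<subseteq> \<gg>\<^sup>a\<^sup>n\<^sup>n\<close>.
\<close>

definition is_tensor_map ::
  "('k::field \<Rightarrow> 'f::ab_group_add \<Rightarrow> 'f) \<Rightarrow> ('f \<Rightarrow> 'f \<Rightarrow> 'f) \<Rightarrow>
   ('k \<Rightarrow> 'g::ab_group_add \<Rightarrow> 'g) \<Rightarrow> ('g \<Rightarrow> 'g \<Rightarrow> 'g) \<Rightarrow> ('f \<Rightarrow> 'g) \<Rightarrow> ('g \<Rightarrow> 'q::ab_group_add) \<Rightarrow>
   ((('g \<times> 'g set) \<Rightarrow>\<^sub>0 'k) set \<Rightarrow> 'f set) \<Rightarrow> bool" where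
  "is_tensor_map sf bf sg bg \<rho> f j \<longleftrightarrow>
     klinear (tensor (sub_space sg (ker f)) (lie_quotient sg bg)) (HL2 sf bf (ker \<rho>)) j \<and>
     (\<forall>s\<in>ker (f \<circ> \<rho>). \<forall>y.
        j (pure_tensor (sub_space sg (ker f)) (lie_quotient sg bg)
             (\<rho> s) (coset (lie_ann sg bg) (\<rho> y)))
        = coset (lie_commutator sf bf (ker \<rho>) UNIV) (bf s y + bf y s))"

end

theory Submission
  imports Defs
begin

text \<open>
  Every condition amounts to \<open>\<nn> \<subseteq> \<gg>\<^sup>a\<^sup>n\<^sup>n\<close>.
  The kernel of \<open>\<nn> \<rightarrow> \<gg>\<^sub>L\<^sub>i\<^sub>e\<close> is
  \<open>\<nn> \<inter> \<gg>\<^sup>a\<^sup>n\<^sup>n\<close>, which settles (b).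
  As \<open>f\<close> maps \<open>\<gg>\<^sup>a\<^sup>n\<^sup>n\<close> onto \<open>\<qq>\<^sup>a\<^sup>n\<^sup>n\<close>, the surjection
  \<open>\<gg>\<^sub>L\<^sub>i\<^sub>e \<rightarrow> \<qq>\<^sub>L\<^sub>i\<^sub>e\<close> has kernel
  \<open>(\<nn> + \<gg>\<^sup>a\<^sup>n\<^sup>n) / \<gg>\<^sup>a\<^sup>n\<^sup>n\<close>, which settles (a).
  Since 2 is invertible, \<open>[\<ff>, \<ff>]\<^sub>L\<^sub>i\<^sub>e = \<ff>\<^sup>a\<^sup>n\<^sup>n\<close>, and \<open>\<rho>\<close> maps it onto
  \<open>\<gg>\<^sup>a\<^sup>n\<^sup>n\<close>; so the image of \<open>\<theta>\<^sup>*(\<gg>)\<close> is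
  \<open>\<rho>(\<ss> \<inter> \<ff>\<^sup>a\<^sup>n\<^sup>n) = \<nn> \<inter> \<gg>\<^sup>a\<^sup>n\<^sup>n\<close>, which settles (c).
  Exactness at \<open>\<nn>\<close> is (c), and exactness at \<open>HL\<^sub>2(\<qq>)\<close> always holds because
  both sides are the classes of \<open>\<rr> \<inter> \<ff>\<^sup>a\<^sup>n\<^sup>n\<close>.

  What remains for (d) is the map on \<open>\<nn> \<otimes> \<gg>\<^sub>L\<^sub>i\<^sub>e\<close>.  Once it exists, its image
  consists of the classes of \<open>[\<ss>, \<ff>]\<^sub>L\<^sub>i\<^sub>e\<close>, which lies in \<open>\<rr>\<close> by Lie-centrality,
  and this is the kernel of \<open>HL\<^sub>2(\<gg>) \<rightarrow> HL\<^sub>2(\<qq>)\<close>.  Its existence is the only delicate point: it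
  requires \<open>[s, y] + [y, s] \<in> [\<rr>, \<ff>]\<^sub>L\<^sub>i\<^sub>e\<close> for \<open>s \<in> \<ss>\<close> and
  \<open>\<rho> y \<in> \<gg>\<^sup>a\<^sup>n\<^sup>n\<close>.  If \<open>\<nn> \<subseteq> \<gg>\<^sup>a\<^sup>n\<^sup>n\<close>, then both \<open>s\<close> and
  \<open>y\<close> lie in \<open>\<ff>\<^sup>a\<^sup>n\<^sup>n + \<rr>\<close>.  The terms with a factor in \<open>\<rr>\<close> are harmless, and two
  elements of \<open>\<ff>\<^sup>a\<^sup>n\<^sup>n\<close> have bracket zero by the Leibniz identity (\<open>sym_ann_in_rF\<close>).
\<close>

section \<open>Quotient spaces and induced maps\<close>

lemma Collect_image: "{y \<in> h ` A. P y} = h ` {x \<in> A. P (h x)}"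
  by blast

context vector_space
begin

lemma coset_eq_iff:
  assumes "subspace W"
  shows "coset W x = coset W y \<longleftrightarrow> x - y \<in> W"
proof
  assume "coset W x = coset W y"
  moreover have "x \<in> coset W x"
    unfolding coset_def using subspace_0[OF assms] by force
  ultimately obtain w where "x = y + w" "w \<in> W"
    unfolding coset_def by blast
  then show "x - y \<in> W" by simp
next
  assume xy: "x - y \<in> W"
  have "z \<in> coset W x \<longleftrightarrow> z \<in> coset W y" for z
  proof -
    have "z \<in> coset W u \<longleftrightarrow> z - u \<in> W" for u
      unfolding coset_def by (force simp: algebra_simps)
    moreover have "z - x \<in> W \<longleftrightarrow> z - y \<in> W"
      using subspace_add[OF assms xy, of "z - x"] subspace_diff[OF assms _ xy, of "z - y"]
      by auto
    ultimately show ?thesis by blast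
  qed
  then show "coset W x = coset W y" by blast
qed

lemma coset_zero: "coset W 0 = W"
  by (simp add: coset_def)

lemma coset_eq_self_iff:
  assumes "subspace W"
  shows "coset W x = W \<longleftrightarrow> x \<in> W"
  using coset_eq_iff[OF assms, of x 0] by (simp add: coset_zero)

lemma quot_space_add:
  assumes "subspace W"
  shows "add (quot_space scale U W) (coset W x) (coset W y) = coset W (x + y)"
proof -
  have "{c + d |c d. c \<in> coset W x \<and> d \<in> coset W y} = coset W (x + y)"
  proof (intro equalityI subsetI)
    fix z assume "z \<in> {c + d |c d. c \<in> coset W x \<and> d \<in> coset W y}"
    then obtain v w where "z = (x + v) + (y + w)" "v \<in> W" "w \<in> W"
      unfolding coset_def by blast
    then have "z = (x + y) + (v + w)" "v + w \<in> W"
      using subspace_add[OF assms] by (auto simp: algebra_simps)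
    then show "z \<in> coset W (x + y)" unfolding coset_def by blast
  next
    fix z assume "z \<in> coset W (x + y)"
    then obtain w where "z = (x + 0) + (y + w)" "w \<in> W"
      unfolding coset_def by (auto simp: add.assoc)
    then show "z \<in> {c + d |c d. c \<in> coset W x \<and> d \<in> coset W y}"
      unfolding coset_def using subspace_0[OF assms] by blast
  qed
  then show ?thesis by (simp add: quot_space_def)
qed

lemma quot_space_smul:
  assumes "subspace W"
  shows "smul (quot_space scale U W) a (coset W x) = coset W (scale a x)"
proof -
  have "{scale a c + w |c w. c \<in> coset W x \<and> w \<in> W} = coset W (scale a x)"
  proof (intro equalityI subsetI)
    fix z assume "z \<in> {scale a c + w |c w. c \<in> coset W x \<and> w \<in> W}"
    then obtain v w where "z = scale a (x + v) + w" "v \<in> W" "w \<in> W"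
      unfolding coset_def by blast
    then have "z = scale a x + (scale a v + w)" "scale a v + w \<in> W"
      using subspace_add[OF assms] subspace_scale[OF assms]
      by (auto simp: scale_right_distrib add.assoc)
    then show "z \<in> coset W (scale a x)" unfolding coset_def by blast
  next
    fix z assume "z \<in> coset W (scale a x)"
    then obtain w where "z = scale a (x + 0) + w" "w \<in> W"
      unfolding coset_def by auto
    then show "z \<in> {scale a c + w |c w. c \<in> coset W x \<and> w \<in> W}"
      unfolding coset_def using subspace_0[OF assms] by blast
  qed
  then show ?thesis by (simp add: quot_space_def)
qed

end

lemma linear_subspace_vimage:
  assumes "Vector_Spaces.linear sa sb h" "module.subspace sb W"
  shows "module.subspace sa {x. h x \<in> W}"
proof -
  interpret Vector_Spaces.linear sa sb h by fact
  show ?thesis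
    using assms(2) by (auto simp: vs1.subspace_def vs2.subspace_def add scale zero)
qed

lemma quot_map_coset:
  assumes lin: "Vector_Spaces.linear sa sb h"
    and W: "module.subspace sa W" and W': "module.subspace sb W'" and "h ` W \<subseteq> W'"
  shows "quot_map W' h (coset W x) = coset W' (h x)"
proof -
  interpret Vector_Spaces.linear sa sb h by fact
  show ?thesis
  proof (intro equalityI subsetI)
    fix z assume "z \<in> quot_map W' h (coset W x)"
    then obtain w w' where "z = h (x + w) + w'" "w \<in> W" "w' \<in> W'"
      unfolding quot_map_def coset_def by blast
    then have "z = h x + (h w + w')" "h w + w' \<in> W'"
      using vs2.subspace_add[OF W'] assms(4) by (auto simp: add add.assoc)
    then show "z \<in> coset W' (h x)" unfolding coset_def by blast
  next
    fix z assume "z \<in> coset W' (h x)"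
    then obtain w' where "z = h (x + 0) + w'" "w' \<in> W'"
      unfolding coset_def by auto
    then show "z \<in> quot_map W' h (coset W x)"
      unfolding quot_map_def coset_def using vs1.subspace_0[OF W] by blast
  qed
qed

lemma klinear_quot_map:
  assumes lin: "Vector_Spaces.linear sa sb h"
    and W: "module.subspace sa W" and W': "module.subspace sb W'" and WW': "h ` W \<subseteq> W'"
    and UU': "h ` U \<subseteq> U'"
  shows "klinear (quot_space sa U W) (quot_space sb U' W') (quot_map W' h)"
proof -
  interpret Vector_Spaces.linear sa sb h by fact
  have car: "car (quot_space s X Y) = coset Y ` X" for s :: "'a \<Rightarrow> 'x::ab_group_add \<Rightarrow> 'x" and X Y
    by (simp add: quot_space_def)
  note map = quot_map_coset[OF lin W W' WW']
  show ?thesis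
    unfolding klinear_def car
    using UU' by (auto simp: map vs1.quot_space_add[OF W] vs2.quot_space_add[OF W']
        vs1.quot_space_smul[OF W] vs2.quot_space_smul[OF W'] add scale)
qed


section \<open>Linear maps out of tensor products\<close>

lemma lookup_pm_scale: "Poly_Mapping.lookup (pm_scale c p) k = c * Poly_Mapping.lookup p k"
  by (simp add: pm_scale_def Poly_Mapping.map.rep_eq when_def)

lemma vector_space_pm_scale: "vector_space (pm_scale :: 'k::field \<Rightarrow> ('i \<Rightarrow>\<^sub>0 'k) \<Rightarrow> _)"
  by standard
    (auto intro!: poly_mapping_eqI simp: lookup_pm_scale lookup_add algebra_simps)

definition pm_extend :: "('k::field \<Rightarrow> 'a::ab_group_add \<Rightarrow> 'a) \<Rightarrow> ('i \<Rightarrow> 'a) \<Rightarrow> ('i \<Rightarrow>\<^sub>0 'k) \<Rightarrow> 'a" where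
  "pm_extend scale b p = (\<Sum>k\<in>Poly_Mapping.keys p. scale (Poly_Mapping.lookup p k) (b k))"

context vector_space
begin

lemma pm_extend_superset:
  assumes "finite A" "Poly_Mapping.keys p \<subseteq> A"
  shows "pm_extend scale b p = (\<Sum>k\<in>A. scale (Poly_Mapping.lookup p k) (b k))"
  unfolding pm_extend_def
  by (rule sum.mono_neutral_left) (use assms in \<open>auto simp: in_keys_iff\<close>)

lemma linear_pm_extend: "Vector_Spaces.linear pm_scale scale (pm_extend scale b)"
proof -
  have "pm_extend scale b (p + q) = pm_extend scale b p + pm_extend scale b q" for p q
  proof -
    let ?A = "Poly_Mapping.keys p \<union> Poly_Mapping.keys q"
    have "Poly_Mapping.keys (p + q) \<subseteq> ?A" by (rule Poly_Mapping.keys_add)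
    then show ?thesis
      by (simp add: pm_extend_superset[of ?A] lookup_add scale_left_distrib sum.distrib)
  qed
  moreover have "pm_extend scale b (pm_scale c p) = scale c (pm_extend scale b p)" for c p
  proof -
    have "Poly_Mapping.keys (pm_scale c p) \<subseteq> Poly_Mapping.keys p"
      by (auto simp: in_keys_iff lookup_pm_scale)
    then show ?thesis
      by (simp add: pm_extend_superset[of "Poly_Mapping.keys p"] lookup_pm_scale
          scale_sum_right)
  qed
  ultimately show ?thesis
    using vector_space_pm_scale vector_space_axioms by (simp add: Vector_Spaces.linear_iff)
qed

lemma pm_extend_single: "pm_extend scale b (Poly_Mapping.single k 1) = b k"
  by (simp add: pm_extend_def)

lemma pm_extend_image: "pm_extend scale b ` {p. Poly_Mapping.keys p \<subseteq> A} = span (b ` A)"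
proof
  show "pm_extend scale b ` {p. Poly_Mapping.keys p \<subseteq> A} \<subseteq> span (b ` A)"
    by (auto simp: pm_extend_def intro!: span_sum span_scale intro: span_base)
next
  interpret P: vector_space "pm_scale :: 'a \<Rightarrow> ('c \<Rightarrow>\<^sub>0 'a) \<Rightarrow> _"
    by (rule vector_space_pm_scale)
  interpret E: Vector_Spaces.linear pm_scale scale "pm_extend scale b"
    by (rule linear_pm_extend)
  have "P.subspace {p. Poly_Mapping.keys p \<subseteq> A}"
  proof (rule P.subspaceI)
    show "p + q \<in> {p. Poly_Mapping.keys p \<subseteq> A}"
      if "p \<in> {p. Poly_Mapping.keys p \<subseteq> A}" "q \<in> {p. Poly_Mapping.keys p \<subseteq> A}" for p q :: "'c \<Rightarrow>\<^sub>0 'a"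
      using that Poly_Mapping.keys_add[of p q] by blast
    show "pm_scale c p \<in> {p. Poly_Mapping.keys p \<subseteq> A}"
      if "p \<in> {p. Poly_Mapping.keys p \<subseteq> A}" for c :: 'a and p :: "'c \<Rightarrow>\<^sub>0 'a"
      using that by (auto simp: in_keys_iff lookup_pm_scale)
  qed simp
  then have "subspace (pm_extend scale b ` {p. Poly_Mapping.keys p \<subseteq> A})"
    by (rule E.subspace_image)
  moreover have "b ` A \<subseteq> pm_extend scale b ` {p. Poly_Mapping.keys p \<subseteq> A}"
  proof
    fix x assume "x \<in> b ` A"
    then obtain k where "k \<in> A" "x = b k" by blast
    then show "x \<in> pm_extend scale b ` {p. Poly_Mapping.keys p \<subseteq> A}"
      by (intro image_eqI[of _ _ "Poly_Mapping.single k 1"]) (auto simp: pm_extend_single)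
  qed
  ultimately show "span (b ` A) \<subseteq> pm_extend scale b ` {p. Poly_Mapping.keys p \<subseteq> A}"
    by (rule span_minimal[rotated])
qed

end

text \<open>
  A map \<open>V \<otimes> W \<rightarrow> U/R\<close> is often given by representatives \<open>b (v, w) \<in> U\<close> that are
  bilinear in \<open>(v, w)\<close> only up to \<open>R\<close>.  Extending \<open>b\<close> linearly to the free vector space first
  and passing to cosets afterwards keeps all computations among elements instead of cosets.
\<close>

locale bilinear_modulo = vector_space scale
  for scale :: "'k::field \<Rightarrow> 'a::ab_group_add \<Rightarrow> 'a" +
  fixes V :: "('k, 'v, 'm) kspace_scheme" and W :: "('k, 'w, 'n) kspace_scheme"
    and U R :: "'a set" and b :: "'v \<times> 'w \<Rightarrow> 'a"
  assumes subspace_U: "subspace U" and subspace_R: "subspace R"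
    and value_in: "\<lbrakk>v \<in> car V; w \<in> car W\<rbrakk> \<Longrightarrow> b (v, w) \<in> U"
    and add_left: "\<lbrakk>v \<in> car V; v' \<in> car V; w \<in> car W\<rbrakk> \<Longrightarrow>
          b (add V v v', w) - b (v, w) - b (v', w) \<in> R"
    and add_right: "\<lbrakk>v \<in> car V; w \<in> car W; w' \<in> car W\<rbrakk> \<Longrightarrow>
          b (v, add W w w') - b (v, w) - b (v, w') \<in> R"
    and smul_left: "\<lbrakk>v \<in> car V; w \<in> car W\<rbrakk> \<Longrightarrow> b (smul V c v, w) - scale c (b (v, w)) \<in> R"
    and smul_right: "\<lbrakk>v \<in> car V; w \<in> car W\<rbrakk> \<Longrightarrow> b (v, smul W c w) - scale c (b (v, w)) \<in> R"
begin

abbreviation "lift \<equiv> quot_map R (pm_extend scale b)"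

sublocale P: vector_space "pm_scale :: 'k \<Rightarrow> (('v \<times> 'w) \<Rightarrow>\<^sub>0 'k) \<Rightarrow> _"
  by (rule vector_space_pm_scale)

sublocale E: Vector_Spaces.linear pm_scale scale "pm_extend scale b"
  by (rule linear_pm_extend)

lemma subspace_tensor_rel: "P.subspace (tensor_rel V W)"
  unfolding tensor_rel_def by (rule P.subspace_span)

lemma extend_tensor_rel: "pm_extend scale b ` tensor_rel V W \<subseteq> R"
proof -
  have "tensor_rel V W \<subseteq> {p. pm_extend scale b p \<in> R}"
    unfolding tensor_rel_def
    by (rule P.span_minimal)
      (auto simp: E.diff E.scale pm_extend_single add_left add_right smul_left smul_right
        intro!: linear_subspace_vimage[OF linear_pm_extend subspace_R])
  then show ?thesis by blast
qed

lemmas lift_coset =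
  quot_map_coset[OF linear_pm_extend subspace_tensor_rel subspace_R extend_tensor_rel]

lemma klinear_lift: "klinear (tensor V W) (quot_space scale U R) lift"
  unfolding tensor_def
proof (rule klinear_quot_map[OF linear_pm_extend subspace_tensor_rel subspace_R extend_tensor_rel])
  have "span (b ` (car V \<times> car W)) \<subseteq> U"
    by (rule span_minimal) (use value_in subspace_U in auto)
  then show "pm_extend scale b ` {p. Poly_Mapping.keys p \<subseteq> car V \<times> car W} \<subseteq> U"
    by (simp add: pm_extend_image)
qed

lemma lift_pure_tensor: "lift (pure_tensor V W v w) = coset R (b (v, w))"
  by (simp add: pure_tensor_def lift_coset pm_extend_single)

lemma lift_image: "lift ` car (tensor V W) = coset R ` span (b ` (car V \<times> car W))"
proof -
  have "lift ` car (tensor V W)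
      = (\<lambda>p. coset R (pm_extend scale b p)) ` {p. Poly_Mapping.keys p \<subseteq> car V \<times> car W}"
    by (simp add: tensor_def quot_space_def image_image lift_coset)
  also have "\<dots> = coset R ` pm_extend scale b ` {p. Poly_Mapping.keys p \<subseteq> car V \<times> car W}"
    by (simp add: image_image)
  finally show ?thesis by (simp add: pm_extend_image)
qed

end


section \<open>The annihilator and Lie commutators\<close>

context leibniz_algebra
begin

abbreviation "ann \<equiv> lie_ann scale bracket"
abbreviation "comm \<equiv> lie_commutator scale bracket"

definition sym where "sym x y = bracket x y + bracket y x"

lemma sym_commute: "sym x y = sym y x"
  by (simp add: sym_def add.commute)

lemma sym_simps:
  "sym (x + y) z = sym x z + sym y z" "sym z (x + y) = sym z x + sym z y"
  "sym (x - y) z = sym x z - sym y z" "sym z (x - y) = sym z x - sym z y"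
  "sym (scale a x) z = scale a (sym x z)" "sym z (scale a x) = scale a (sym z x)"
proof -
  show add: "sym (x + y) z = sym x z + sym y z" for x y z
    by (simp add: sym_def bracket_simps algebra_simps)
  show scale: "sym (scale a x) z = scale a (sym x z)" for x z
    by (simp add: sym_def bracket_simps scale_right_distrib)
  show diff: "sym (x - y) z = sym x z - sym y z" for x y z
    using add[of "x - y" y z] by (simp add: algebra_simps)
  show "sym z (x + y) = sym z x + sym z y" "sym z (x - y) = sym z x - sym z y"
    "sym z (scale a x) = scale a (sym z x)"
    using add diff scale by (simp_all add: sym_commute[of z])
qed

lemma comm_eq: "comm M N = span {sym m n |m n. m \<in> M \<and> n \<in> N}"
  by (simp add: lie_commutator_def sym_def)

lemma subspace_comm: "subspace (comm M N)"
  by (simp add: comm_eq)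

lemma subspace_ann: "subspace ann"
  by (simp add: lie_ann_def)

lemma sym_in_comm: "m \<in> M \<Longrightarrow> n \<in> N \<Longrightarrow> sym m n \<in> comm M N"
  unfolding comm_eq by (rule span_base) blast

lemma comm_subset:
  assumes "subspace W" "\<And>m n. m \<in> M \<Longrightarrow> n \<in> N \<Longrightarrow> sym m n \<in> W"
  shows "comm M N \<subseteq> W"
  unfolding comm_eq by (rule span_minimal) (use assms in auto)

lemma comm_mono: "M \<subseteq> M' \<Longrightarrow> N \<subseteq> N' \<Longrightarrow> comm M N \<subseteq> comm M' N'"
  by (intro comm_subset subspace_comm sym_in_comm) auto

lemma square_in_ann: "bracket x x \<in> ann"
  unfolding lie_ann_def by (rule span_base) blast

lemma sym_in_ann: "sym x y \<in> ann"
proof -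
  have "sym x y = bracket (x + y) (x + y) - bracket x x - bracket y y"
    by (simp add: sym_def bracket_simps algebra_simps)
  then show ?thesis
    using subspace_diff[OF subspace_ann] square_in_ann by metis
qed

text \<open>
  Invertibility of 2 gives \<open>[x, x] = ([x, x] + [x, x]) / 2\<close>; the other inclusion is polarization.
\<close>

lemma ann_eq_comm:
  assumes "(2::'k) \<noteq> 0"
  shows "ann = comm UNIV UNIV"
proof
  have "bracket x x \<in> comm UNIV UNIV" for x
  proof -
    have "sym x x = scale 2 (bracket x x)"
      using scale_left_distrib[of 1 1 "bracket x x"] by (simp add: sym_def)
    then have "bracket x x = scale (1 / 2) (sym x x)"
      using assms by simp
    then show ?thesis
      using subspace_scale[OF subspace_comm sym_in_comm] by (metis UNIV_I)
  qed
  then show "ann \<subseteq> comm UNIV UNIV"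
    unfolding lie_ann_def by (intro span_minimal subspace_comm) auto
  show "comm UNIV UNIV \<subseteq> ann"
    by (intro comm_subset subspace_ann sym_in_ann)
qed

text \<open>
  The Leibniz identity with \<open>y = z\<close> reads \<open>[x, [y, y]] = 0\<close>.
\<close>

lemma bracket_ann_right:
  assumes "a \<in> ann"
  shows "bracket x a = 0"
proof -
  have "ann \<subseteq> {a. bracket x a \<in> {0}}"
    unfolding lie_ann_def
    by (intro span_minimal linear_subspace_vimage[OF bracket_linear_right] subspace_single_0)
      (auto simp: leibniz)
  with assms show ?thesis by blast
qed

text \<open>
  \<open>[a, x]\<close> differs from \<open>[a, x] + [x, a]\<close> by \<open>[x, a] = 0\<close>.  With the preceding lemma this
  makes the annihilator a two-sided ideal, so that the bracket of the Lie quotient is well defined.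
\<close>

lemma bracket_ann_left:
  assumes "a \<in> ann"
  shows "bracket a x \<in> ann"
  using sym_in_ann[of a x] by (simp add: sym_def bracket_ann_right[OF assms])

lemma lie_quotient_brk:
  "brk (lie_quotient scale bracket) (coset ann x) (coset ann y) = coset ann (bracket x y)"
proof -
  have "{bracket c d + w |c d w. c \<in> coset ann x \<and> d \<in> coset ann y \<and> w \<in> ann}
      = coset ann (bracket x y)"
  proof (intro equalityI subsetI)
    fix z assume "z \<in> {bracket c d + w |c d w. c \<in> coset ann x \<and> d \<in> coset ann y \<and> w \<in> ann}"
    then obtain u v w where z: "z = bracket (x + u) (y + v) + w" "u \<in> ann" "v \<in> ann" "w \<in> ann"
      unfolding coset_def by blast
    then have "z = bracket x y + (bracket u y + w)"
      by (simp add: bracket_simps bracket_ann_right add.assoc)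
    moreover have "bracket u y + w \<in> ann"
      using z bracket_ann_left subspace_add[OF subspace_ann] by blast
    ultimately show "z \<in> coset ann (bracket x y)" unfolding coset_def by blast
  next
    fix z assume "z \<in> coset ann (bracket x y)"
    then obtain w where "z = bracket (x + 0) (y + 0) + w" "w \<in> ann"
      unfolding coset_def by auto
    then show "z \<in> {bracket c d + w |c d w. c \<in> coset ann x \<and> d \<in> coset ann y \<and> w \<in> ann}"
      unfolding coset_def using subspace_0[OF subspace_ann] by blast
  qed
  then show ?thesis by (simp add: lie_quotient_def quot_algebra_def kspace.defs)
qed

lemma lie_quotient_simps:
  "car (lie_quotient scale bracket) = range (coset ann)"
  "add (lie_quotient scale bracket) = add (quot_space scale UNIV ann)"
  "smul (lie_quotient scale bracket) = smul (quot_space scale UNIV ann)"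
  "zer (lie_quotient scale bracket) = ann"
  by (simp_all add: lie_quotient_def quot_algebra_def kspace.defs quot_space_def)

end

lemma leibniz_hom_ann_image:
  assumes "leibniz_hom sa ba sb bb h" "surj h"
  shows "h ` lie_ann sa ba = lie_ann sb bb"
proof -
  interpret Vector_Spaces.linear sa sb h using assms(1) by (simp add: leibniz_hom_def)
  have "h ` {ba x x |x. True} = {bb y y |y. True}"
  proof (intro equalityI subsetI)
    fix z assume "z \<in> {bb y y |y. True}"
    then obtain y where y: "z = bb y y" by blast
    obtain x where "y = h x" using surjD[OF assms(2)] by blast
    with y have "z = h (ba x x)" using assms(1) by (simp add: leibniz_hom_def)
    then show "z \<in> h ` {ba x x |x. True}" by blast
  qed (use assms(1) in \<open>auto simp: leibniz_hom_def\<close>)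
  then show ?thesis by (simp add: lie_ann_def span_image[symmetric])
qed


section \<open>Presentations of Lie-central extensions\<close>

locale lie_central_presentation =
  G: leibniz_algebra sg bg + Q: leibniz_algebra sq bq + F: leibniz_algebra sf bf
  for sg :: "'k::field \<Rightarrow> 'g::ab_group_add \<Rightarrow> 'g" and bg
    and sq :: "'k \<Rightarrow> 'q::ab_group_add \<Rightarrow> 'q" and bq
    and sf :: "'k \<Rightarrow> 'f::ab_group_add \<Rightarrow> 'f" and bf +
  fixes f :: "'g \<Rightarrow> 'q" and \<rho> :: "'f \<Rightarrow> 'g"
  assumes half: "(2::'k) \<noteq> 0"
    and hom_f: "leibniz_hom sg bg sq bq f" and surj_f: "surj f"
    and hom_rho: "leibniz_hom sf bf sg bg \<rho>" and surj_rho: "surj \<rho>"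
    and central: "lie_commutator sg bg (ker f) UNIV = {0}"
begin

sublocale f: Vector_Spaces.linear sg sq f
  using hom_f by (simp add: leibniz_hom_def)

sublocale rho: Vector_Spaces.linear sf sg \<rho>
  using hom_rho by (simp add: leibniz_hom_def)

abbreviation "r \<equiv> ker \<rho>"
abbreviation "s \<equiv> ker (f \<circ> \<rho>)"
abbreviation "rF \<equiv> F.comm r UNIV"
abbreviation "sF \<equiv> F.comm s UNIV"
abbreviation "HL2g \<equiv> HL2 sf bf r"
abbreviation "HL2q \<equiv> HL2 sf bf s"
abbreviation "N \<equiv> sub_space sg (ker f)"
abbreviation "GLie \<equiv> lie_quotient sg bg"

lemma s_iff: "x \<in> s \<longleftrightarrow> \<rho> x \<in> ker f"
  by (simp add: ker_def)

lemma rho_onto: "\<exists>x. \<rho> x = n"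
  using surjD[OF surj_rho, of n] by metis

lemma r_iff: "x \<in> r \<longleftrightarrow> \<rho> x = 0"
  by (simp add: ker_def)

lemma r_subset_s: "r \<subseteq> s"
  by (auto simp: ker_def f.zero)

lemma subspace_r: "F.subspace r"
  using rho.subspace_kernel by (simp add: ker_def)

lemma rho_sym: "\<rho> (F.sym x y) = G.sym (\<rho> x) (\<rho> y)"
  using hom_rho by (simp add: leibniz_hom_def F.sym_def G.sym_def rho.add)

lemma rho_ann: "\<rho> ` F.ann = G.ann"
  using hom_rho surj_rho by (rule leibniz_hom_ann_image)

lemma f_ann: "f ` G.ann = Q.ann"
  using hom_f surj_f by (rule leibniz_hom_ann_image)

text \<open>
  This is Lie-centrality, lifted to the presentation: \<open>\<rho>\<close> maps \<open>[\<ss>, \<ff>]\<^sub>L\<^sub>i\<^sub>e\<close> into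
  \<open>[\<nn>, \<gg>]\<^sub>L\<^sub>i\<^sub>e = 0\<close>.
\<close>

lemma sF_subset_r: "sF \<subseteq> r"
proof (rule F.comm_subset[OF subspace_r])
  fix x y :: 'f assume "x \<in> s"
  then have "G.sym (\<rho> x) (\<rho> y) \<in> G.comm (ker f) UNIV"
    by (intro G.sym_in_comm) (auto simp: s_iff)
  then show "F.sym x y \<in> r"
    using central by (simp add: ker_def rho_sym)
qed

lemma HL2_eq: "HL2 sf bf x = quot_space sf (x \<inter> F.ann) (F.comm x UNIV)"
  by (simp add: HL2_def F.ann_eq_comm[OF half])

lemma HL2_map_coset: "HL2_map sf bf s (coset rF x) = coset sF x"
  unfolding HL2_map_def
  by (subst quot_map_coset[OF F.linear_id F.subspace_comm F.subspace_comm])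
    (use F.comm_mono[OF r_subset_s] in auto)

lemma klinear_HL2_map: "klinear HL2g HL2q (HL2_map sf bf s)"
  unfolding HL2_map_def HL2_eq
  by (rule klinear_quot_map[OF F.linear_id F.subspace_comm F.subspace_comm])
    (use F.comm_mono[OF r_subset_s] r_subset_s in auto)

lemma theta_coset: "theta \<rho> (coset sF x) = \<rho> x"
proof -
  have "\<rho> ` coset sF x = {\<rho> x}"
  proof
    show "\<rho> ` coset sF x \<subseteq> {\<rho> x}"
      using sF_subset_r by (auto simp: coset_def ker_def rho.add)
    have "x + 0 \<in> coset sF x"
      unfolding coset_def using F.subspace_0[OF F.subspace_comm] by blast
    then show "{\<rho> x} \<subseteq> \<rho> ` coset sF x" by auto
  qed
  then show ?thesis by (simp add: theta_def)
qed

lemma klinear_theta: "klinear HL2q N (theta \<rho>)"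
proof -
  have "car HL2q = coset sF ` (s \<inter> F.ann)" by (simp add: HL2_eq quot_space_def)
  moreover have "add HL2q (coset sF x) (coset sF y) = coset sF (x + y)"
    and "smul HL2q c (coset sF x) = coset sF (sf c x)" for x y c
    by (simp_all add: HL2_eq F.quot_space_add[OF F.subspace_comm]
        F.quot_space_smul[OF F.subspace_comm])
  ultimately show ?thesis
    by (simp add: klinear_def theta_coset sub_space_def rho.add rho.scale s_iff)
qed

text \<open>
  An element of \<open>\<nn> \<inter> \<gg>\<^sup>a\<^sup>n\<^sup>n\<close> has a preimage in \<open>\<ff>\<^sup>a\<^sup>n\<^sup>n\<close>, which lies in
  \<open>\<ss>\<close> automatically.
\<close>

lemma theta_image: "theta \<rho> ` car HL2q = ker f \<inter> G.ann"
proof -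
  have "theta \<rho> ` car HL2q = \<rho> ` (s \<inter> F.ann)"
    by (simp add: HL2_eq quot_space_def image_image theta_coset)
  also have "\<dots> = ker f \<inter> G.ann"
    by (auto simp: rho_ann[symmetric] s_iff)
  finally show ?thesis .
qed

text \<open>
  The induced map of Lie quotients is always a surjective homomorphism, so only its injectivity is at
  stake.  If \<open>f x\<close> and \<open>f y\<close> agree modulo \<open>\<qq>\<^sup>a\<^sup>n\<^sup>n = f \<gg>\<^sup>a\<^sup>n\<^sup>n\<close>, then \<open>x - y\<close> lies in
  \<open>\<gg>\<^sup>a\<^sup>n\<^sup>n + \<nn>\<close>.
\<close>

lemma stem_iff_ker_subset_ann: "lie_stem_extension sg bg sq bq f \<longleftrightarrow> ker f \<subseteq> G.ann"
proof -
  let ?h = "quot_map Q.ann f"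
  note map = quot_map_coset[OF f.linear_axioms G.subspace_ann Q.subspace_ann equalityD1[OF f_ann]]
  have lin: "klinear GLie (lie_quotient sq bq) ?h"
    using klinear_quot_map[OF f.linear_axioms G.subspace_ann Q.subspace_ann
        equalityD1[OF f_ann], of UNIV UNIV]
    by (simp add: klinear_def G.lie_quotient_simps Q.lie_quotient_simps quot_space_def)
  have brk: "\<forall>x\<in>car GLie. \<forall>y\<in>car GLie.
      ?h (brk GLie x y) = brk (lie_quotient sq bq) (?h x) (?h y)"
    using hom_f
    by (auto simp: G.lie_quotient_simps G.lie_quotient_brk Q.lie_quotient_brk map leibniz_hom_def)
  have surj: "?h ` car GLie = car (lie_quotient sq bq)"
  proof -
    have "?h ` car GLie = coset Q.ann ` range f"
      by (simp add: G.lie_quotient_simps map image_image)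
    then show ?thesis using surj_f by (simp add: Q.lie_quotient_simps)
  qed
  have inj: "inj_on ?h (car GLie) \<longleftrightarrow> ker f \<subseteq> G.ann"
  proof
    assume inj: "inj_on ?h (car GLie)"
    show "ker f \<subseteq> G.ann"
    proof
      fix n assume "n \<in> ker f"
      then have "?h (coset G.ann n) = ?h (coset G.ann 0)"
        by (simp add: map ker_def f.zero)
      then have "coset G.ann n = coset G.ann 0"
        using inj by (auto simp: inj_on_def G.lie_quotient_simps)
      then show "n \<in> G.ann" by (simp add: G.coset_eq_iff[OF G.subspace_ann])
    qed
  next
    assume ker: "ker f \<subseteq> G.ann"
    have "coset G.ann x = coset G.ann y" if "?h (coset G.ann x) = ?h (coset G.ann y)" for x y
    proof -
      have "f (x - y) \<in> Q.ann"
        using that by (simp add: map Q.coset_eq_iff[OF Q.subspace_ann] f.diff)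
      then obtain a where a: "a \<in> G.ann" "f (x - y) = f a"
        unfolding f_ann[symmetric] by blast
      then have "x - y - a \<in> ker f" by (simp add: ker_def f.diff)
      then have "(x - y - a) + a \<in> G.ann"
        using ker a G.subspace_add[OF G.subspace_ann] by blast
      then show ?thesis by (simp add: G.coset_eq_iff[OF G.subspace_ann])
    qed
    then show "inj_on ?h (car GLie)"
      by (auto simp: inj_on_def G.lie_quotient_simps)
  qed
  have "lie_central_extension sg bg sq bq f"
    using hom_f surj_f central G.leibniz_algebra_axioms Q.leibniz_algebra_axioms
    by (simp add: lie_central_extension_def leibniz_extension_def)
  then show ?thesis
    using lin brk surj inj
    by (simp add: lie_stem_extension_def kalgebra_iso_def bij_betw_def)
qed

text \<open>
  Modulo \<open>\<rr>\<close> both arguments can be replaced by elements of \<open>\<ff>\<^sup>a\<^sup>n\<^sup>n\<close>, on which the symmetrized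
  bracket vanishes.  This is what makes the tensor map independent of the representative of a class
  in \<open>\<gg>\<^sub>L\<^sub>i\<^sub>e\<close>; without \<open>\<nn> \<subseteq> \<gg>\<^sup>a\<^sup>n\<^sup>n\<close> the first argument could not be moved into
  \<open>\<ff>\<^sup>a\<^sup>n\<^sup>n\<close>.
\<close>

lemma sym_ann_in_rF:
  assumes stem: "ker f \<subseteq> G.ann" and "x \<in> s" "\<rho> y \<in> G.ann"
  shows "F.sym x y \<in> rF"
proof -
  have split: "\<exists>a\<in>F.ann. u - a \<in> r" if "\<rho> u \<in> G.ann" for u
    using that unfolding rho_ann[symmetric] by (force simp: ker_def rho.diff)
  obtain a where a: "a \<in> F.ann" "x - a \<in> r"
    using split[of x] stem assms(2) by (auto simp: s_iff)
  obtain b where b: "b \<in> F.ann" "y - b \<in> r"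
    using split assms(3) by blast
  have "F.sym a b = 0"
    using a b by (simp add: F.sym_def F.bracket_ann_right)
  \<comment> \<open>each summand has an argument in \<open>\<rr>\<close>\<close>
  then have "F.sym x y = F.sym (x - a) b + F.sym (y - b) x"
    by (simp add: F.sym_simps F.sym_commute[of _ x])
  then show ?thesis
    using F.subspace_add[OF F.subspace_comm] F.sym_in_comm a b by (metis UNIV_I)
qed

definition rho_preimage where "rho_preimage n = (SOME x. \<rho> x = n)"
definition GLie_rep where "GLie_rep C = (SOME y. coset G.ann (\<rho> y) = C)"
definition \<beta> where "\<beta> = (\<lambda>(n, C). F.sym (rho_preimage n) (GLie_rep C))"

text \<open>
  The formula for the tensor map involves lifts to \<open>\<ff>\<close>.  Here \<open>\<beta>\<close> uses arbitrarily chosen lifts,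
  and any other choice changes the value only by an element of \<open>[\<rr>, \<ff>]\<^sub>L\<^sub>i\<^sub>e\<close>.
\<close>

lemma beta_cong:
  assumes stem: "ker f \<subseteq> G.ann" and "x \<in> s"
  shows "F.sym x y - \<beta> (\<rho> x, coset G.ann (\<rho> y)) \<in> rF"
proof -
  let ?x = "rho_preimage (\<rho> x)" and ?y = "GLie_rep (coset G.ann (\<rho> y))"
  have x: "\<rho> ?x = \<rho> x" unfolding rho_preimage_def by (rule someI) simp
  have "coset G.ann (\<rho> ?y) = coset G.ann (\<rho> y)" unfolding GLie_rep_def by (rule someI) simp
  then have "\<rho> (y - ?y) \<in> G.ann"
    using G.coset_eq_iff[OF G.subspace_ann] by (metis rho.diff)
  moreover have "?x \<in> s" using assms(2) x by (simp add: s_iff)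
  ultimately have "F.sym ?x (y - ?y) \<in> rF" using stem by (intro sym_ann_in_rF)
  moreover have "F.sym (x - ?x) y \<in> rF"
    by (rule F.sym_in_comm) (auto simp: ker_def x rho.diff)
  ultimately have "F.sym (x - ?x) y + F.sym ?x (y - ?y) \<in> rF"
    using F.subspace_add[OF F.subspace_comm] by blast
  then show ?thesis by (simp add: \<beta>_def F.sym_simps)
qed

lemma beta_in_sF:
  assumes "n \<in> ker f"
  shows "\<beta> (n, C) \<in> sF"
proof -
  have "\<rho> (rho_preimage n) = n" unfolding rho_preimage_def by (rule someI_ex) (rule rho_onto)
  then show ?thesis
    using assms by (auto simp: \<beta>_def s_iff intro!: F.sym_in_comm)
qed

lemma sF_subset: "sF \<subseteq> r \<inter> F.ann"
  using sF_subset_r F.comm_mono[of s UNIV UNIV UNIV] by (auto simp: F.ann_eq_comm[OF half])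

context
  assumes stem: "ker f \<subseteq> G.ann"
begin

text \<open>
  The chosen lifts are not linear, so \<open>\<beta>\<close> is bilinear only modulo \<open>[\<rr>, \<ff>]\<^sub>L\<^sub>i\<^sub>e\<close>: by
  \<open>beta_cong\<close> each value may be replaced by the symmetrized bracket of lifts that do add up.
\<close>

lemma beta_bilinear: "bilinear_modulo sf N GLie (r \<inter> F.ann) rF \<beta>"
proof
  show "F.subspace (r \<inter> F.ann)" "F.subspace rF"
    by (auto intro: F.subspace_inter subspace_r F.subspace_ann F.subspace_comm)
  have lift_N: "\<exists>x\<in>s. \<rho> x = n" if "n \<in> car N" for n
    using that rho_onto[of n] by (auto simp: sub_space_def s_iff)
  have lift_G: "\<exists>y. coset G.ann (\<rho> y) = C" if "C \<in> car GLie" for C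
    using that rho_onto by (auto simp: G.lie_quotient_simps) metis
  have add_G: "add GLie (coset G.ann u) (coset G.ann v) = coset G.ann (u + v)"
    and smul_G: "smul GLie c (coset G.ann u) = coset G.ann (sg c u)" for u v c
    by (simp_all add: G.lie_quotient_simps G.quot_space_add[OF G.subspace_ann]
        G.quot_space_smul[OF G.subspace_ann])
  have ops_N: "add N = (+)" "smul N = sg" by (simp_all add: sub_space_def)
  have subspace_s: "F.subspace s"
    using linear_subspace_vimage[OF rho.linear_axioms f.subspace_kernel] by (simp add: ker_def)
  note s_closed = F.subspace_add[OF subspace_s] F.subspace_scale[OF subspace_s]
  note cong = beta_cong[OF stem]
  \<comment> \<open>relations between values at good lifts carry over to values of \<open>\<beta>\<close> modulo \<open>[\<rr>, \<ff>]\<^sub>L\<^sub>i\<^sub>e\<close>\<close>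
  have add_transfer: "p - q - t \<in> rF"
    if "p' - p \<in> rF" "q' - q \<in> rF" "t' - t \<in> rF" "p' = q' + t'" for p q t p' q' t'
  proof -
    have "p - q - t = (q' - q) + (t' - t) - (p' - p)"
      using that(4) by (simp add: algebra_simps)
    then show ?thesis
      using that F.subspace_add[OF F.subspace_comm] F.subspace_diff[OF F.subspace_comm] by metis
  qed
  have smul_transfer: "p - sf c q \<in> rF"
    if "p' - p \<in> rF" "q' - q \<in> rF" "p' = sf c q'" for p q p' q' c
  proof -
    have "p - sf c q = sf c (q' - q) - (p' - p)"
      using that(3) by (simp add: F.scale_right_diff_distrib)
    then show ?thesis
      using that F.subspace_scale[OF F.subspace_comm] F.subspace_diff[OF F.subspace_comm] by metis
  qed
  show "\<beta> (n, C) \<in> r \<inter> F.ann" if "n \<in> car N" for n C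
    using that beta_in_sF sF_subset by (auto simp: sub_space_def)
  fix n C assume n: "n \<in> car N" and C: "C \<in> car GLie"
  obtain x where x: "x \<in> s" "n = \<rho> x" using lift_N n by metis
  obtain y where y: "C = coset G.ann (\<rho> y)" using lift_G C by metis
  show "\<beta> (add N n n', C) - \<beta> (n, C) - \<beta> (n', C) \<in> rF" if n': "n' \<in> car N" for n'
  proof -
    obtain x' where x': "x' \<in> s" "n' = \<rho> x'" using lift_N n' by metis
    show ?thesis
      using add_transfer[OF cong[of "x + x'" y] cong[of x y] cong[of x' y]] x x' s_closed
      by (simp add: y ops_N rho.add F.sym_simps)
  qed
  show "\<beta> (n, add GLie C C') - \<beta> (n, C) - \<beta> (n, C') \<in> rF" if C': "C' \<in> car GLie" for C'
  proof -
    obtain y' where y': "C' = coset G.ann (\<rho> y')" using lift_G C' by metis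
    show ?thesis
      using add_transfer[OF cong[of x "y + y'"] cong[of x y] cong[of x y']] x
      by (simp add: y y' add_G rho.add F.sym_simps)
  qed
  show "\<beta> (smul N c n, C) - sf c (\<beta> (n, C)) \<in> rF" for c
    using smul_transfer[OF cong[of "sf c x" y] cong[of x y]] x s_closed
    by (simp add: y ops_N rho.scale F.sym_simps)
  show "\<beta> (n, smul GLie c C) - sf c (\<beta> (n, C)) \<in> rF" for c
    using smul_transfer[OF cong[of x "sf c y"] cong[of x y]] x
    by (simp add: y smul_G rho.scale F.sym_simps)
qed

interpretation T: bilinear_modulo sf N GLie "r \<inter> F.ann" rF \<beta>
  by (rule beta_bilinear)

lemma tensor_map: "is_tensor_map sf bf sg bg \<rho> f T.lift"
  unfolding is_tensor_map_def HL2_eq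
proof (intro conjI ballI allI T.klinear_lift)
  fix x y assume "x \<in> s"
  then have "coset rF (F.sym x y) = coset rF (\<beta> (\<rho> x, coset G.ann (\<rho> y)))"
    using beta_cong[OF stem] by (simp add: F.coset_eq_iff[OF F.subspace_comm])
  then show "T.lift (pure_tensor N GLie (\<rho> x) (coset G.ann (\<rho> y))) = coset rF (bf x y + bf y x)"
    by (simp add: T.lift_pure_tensor F.sym_def)
qed

text \<open>
  The generators \<open>[s, y] + [y, s]\<close> of \<open>[\<ss>, \<ff>]\<^sub>L\<^sub>i\<^sub>e\<close> agree with values of \<open>\<beta>\<close> modulo
  \<open>[\<rr>, \<ff>]\<^sub>L\<^sub>i\<^sub>e\<close>.
\<close>

lemma tensor_map_image: "T.lift ` car (tensor N GLie) = coset rF ` sF"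
proof -
  let ?S = "F.span (\<beta> ` (car N \<times> car GLie))"
  have "?S \<subseteq> sF"
    by (rule F.span_minimal[OF _ F.subspace_comm]) (auto simp: sub_space_def beta_in_sF)
  moreover have "sF \<subseteq> {a + b |a b. a \<in> ?S \<and> b \<in> rF}"
  proof (rule F.comm_subset)
    show "F.subspace {a + b |a b. a \<in> ?S \<and> b \<in> rF}"
      by (intro F.subspace_sums F.subspace_span F.subspace_comm)
    fix x y assume x: "x \<in> s"
    let ?b = "\<beta> (\<rho> x, coset G.ann (\<rho> y))"
    have "?b \<in> ?S"
      by (rule F.span_base) (use x in \<open>auto simp: sub_space_def s_iff G.lie_quotient_simps\<close>)
    moreover have "F.sym x y = ?b + (F.sym x y - ?b)" by simp
    ultimately show "F.sym x y \<in> {a + b |a b. a \<in> ?S \<and> b \<in> rF}"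
      using beta_cong[OF stem x] by blast
  qed
  moreover have "coset rF (a + b) = coset rF a" if "b \<in> rF" for a b
    using that by (simp add: F.coset_eq_iff[OF F.subspace_comm])
  ultimately have "coset rF ` ?S = coset rF ` sF"
    by (fastforce simp: image_iff subset_iff)
  then show ?thesis by (simp add: T.lift_image)
qed

lemma exact_HL2g: "kexact (tensor N GLie) T.lift HL2g (HL2_map sf bf s) HL2q"
  unfolding kexact_def
proof (intro conjI)
  show "klinear (tensor N GLie) HL2g T.lift"
    using tensor_map by (simp add: is_tensor_map_def)
  show "klinear HL2g HL2q (HL2_map sf bf s)" by (rule klinear_HL2_map)
  have "{C \<in> car HL2g. HL2_map sf bf s C = zer HL2q} = coset rF ` {x \<in> r \<inter> F.ann. x \<in> sF}"
    by (simp add: HL2_eq quot_space_def Collect_image HL2_map_coset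
        F.coset_eq_self_iff[OF F.subspace_comm])
  also have "{x \<in> r \<inter> F.ann. x \<in> sF} = sF" using sF_subset by blast
  finally show "T.lift ` car (tensor N GLie) = {C \<in> car HL2g. HL2_map sf bf s C = zer HL2q}"
    by (simp only: tensor_map_image)
qed

end

lemma exact_HL2q: "kexact HL2g (HL2_map sf bf s) HL2q (theta \<rho>) N"
  unfolding kexact_def
proof (intro conjI klinear_HL2_map klinear_theta)
  have "{C \<in> car HL2q. theta \<rho> C = zer N} = coset sF ` (s \<inter> F.ann \<inter> r)"
    by (simp add: HL2_eq quot_space_def Collect_image theta_coset sub_space_def r_iff Int_def)
  also have "s \<inter> F.ann \<inter> r = r \<inter> F.ann" using r_subset_s by blast
  also have "coset sF ` (r \<inter> F.ann) = HL2_map sf bf s ` car HL2g"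
    by (simp add: HL2_eq quot_space_def image_image HL2_map_coset)
  finally show "HL2_map sf bf s ` car HL2g = {C \<in> car HL2q. theta \<rho> C = zer N}"
    by (rule sym)
qed

lemma epi_iff_ker_subset_ann: "kepi HL2q N (theta \<rho>) \<longleftrightarrow> ker f \<subseteq> G.ann"
  unfolding kepi_def theta_image inf.absorb_iff1 using klinear_theta by (simp add: sub_space_def)

lemma exact_N_iff_epi: "kexact HL2q (theta \<rho>) N (\<lambda>_. 0) (sub_space sg {0}) \<longleftrightarrow> kepi HL2q N (theta \<rho>)"
proof -
  have "klinear N (sub_space sg {0}) (\<lambda>_. 0)" by (simp add: klinear_def sub_space_def)
  then show ?thesis by (simp add: kexact_def kepi_def sub_space_def)
qed

lemma zero_map_iff_ker_subset_ann: "kzero_map N (HL1 sg bg) (coset G.ann) \<longleftrightarrow> ker f \<subseteq> G.ann"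
  by (simp add: kzero_map_def HL1_def G.lie_quotient_simps sub_space_def
      G.coset_eq_self_iff[OF G.subspace_ann] subset_eq)

end

theorem proposition3p12:
  fixes sg :: "'k::field \<Rightarrow> 'g::ab_group_add \<Rightarrow> 'g" and bg :: "'g \<Rightarrow> 'g \<Rightarrow> 'g"
    and sq :: "'k \<Rightarrow> 'q::ab_group_add \<Rightarrow> 'q" and bq :: "'q \<Rightarrow> 'q \<Rightarrow> 'q"
    and sf :: "'k \<Rightarrow> 'f::ab_group_add \<Rightarrow> 'f" and bf :: "'f \<Rightarrow> 'f \<Rightarrow> 'f"
    and f :: "'g \<Rightarrow> 'q" and \<rho> :: "'f \<Rightarrow> 'g"
  assumes half: "(2::'k) \<noteq> 0"
    and central: "lie_central_extension sg bg sq bq f"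
    and presentation: "free_presentation sf bf sg bg \<rho>"
  shows
    "let N = sub_space sg (ker f);
         HL2_g = HL2 sf bf (ker \<rho>);
         HL2_q = HL2 sf bf (ker (f \<circ> \<rho>));
         a = lie_stem_extension sg bg sq bq f;
         b = kzero_map N (HL1 sg bg) (coset (lie_ann sg bg));
         c = kepi HL2_q N (theta \<rho>);
         d = (\<exists>j. is_tensor_map sf bf sg bg \<rho> f j \<and>
                kexact (tensor N (lie_quotient sg bg)) j
                  HL2_g (HL2_map sf bf (ker (f \<circ> \<rho>))) HL2_q \<and>
                kexact HL2_g (HL2_map sf bf (ker (f \<circ> \<rho>))) HL2_q (theta \<rho>) N \<and>
                kexact HL2_q (theta \<rho>) N (\<lambda>_. 0) (sub_space sg {0}));
         e = (ker f \<subseteq> lie_ann sg bg)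
     in (a \<longleftrightarrow> b) \<and> (b \<longleftrightarrow> c) \<and> (c \<longleftrightarrow> d) \<and> (d \<longleftrightarrow> e)"
proof -
  have "leibniz_algebra sf bf" "leibniz_algebra sg bg" "leibniz_algebra sq bq"
    "leibniz_hom sg bg sq bq f" "surj f" "leibniz_hom sf bf sg bg \<rho>" "surj \<rho>"
    "lie_commutator sg bg (ker f) UNIV = {0}"
    using central presentation
    by (auto simp: lie_central_extension_def leibniz_extension_def free_presentation_def)
  then interpret lie_central_presentation sg bg sq bq sf bf f \<rho>
    using half by (intro lie_central_presentation.intro lie_central_presentation_axioms.intro)
  have "\<exists>j. is_tensor_map sf bf sg bg \<rho> f j \<and>
      kexact (tensor N GLie) j HL2g (HL2_map sf bf s) HL2q" if "ker f \<subseteq> G.ann"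
    using tensor_map[OF that] exact_HL2g[OF that] by blast
  then show ?thesis
    unfolding Let_def
    using stem_iff_ker_subset_ann zero_map_iff_ker_subset_ann epi_iff_ker_subset_ann
      exact_N_iff_epi exact_HL2q
    by blast
qed

end
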